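(* Let $\mathcal{U}$ be a compact topological space and let $\mathbb{X}$ be a real normed linear space. Let $f,g\in \mathcal{C}(\mathcal{U},\mathbb{X})$ be non-zero. Then $f\perp_B g$ if and only if there exist $u_1,u_2\in\mathcal{M}_f$ such that $g(u_1)\in f(u_1)^+$ and $g(u_2)\in f(u_2)^-$.
   Context: All normed linear spaces are real. $\mathcal{C}(\mathcal{U},\mathbb{X})$ is the real normed linear space of all continuous functions from $\mathcal{U}$ to $\mathbb{X}$, with norm $\|f\|_{\mathcal{U}}=\sup_{u\in\mathcal{U}}\|f(u)\|$. For $f\in\mathcal{C}(\mathcal{U},\mathbb{X})$, the norm attainment set is $\mathcal{M}_f=\{u\in\mathcal{U}:\|f(u)\|=\|f\|_{\mathcal{U}}\}$. For elements $x,y$ of a real normed linear space, $x$ is Birkhoff-James orthogonal to $y$, written $x\perp_B y$, if $\|x+\lambda y\|\geq\|x\|$ for all $\lambda\in\mathbb{R}$. In $\mathcal{C}(\mathcal{U},\mathbb{X})$ this is taken with respect to $\|\cdot\|_{\mathcal{U}}$. For a non-zero $x\in\mathbb{X}$, $x^+=\{y\in\mathbb{X}:\|x+\lambda y\|\geq\|x\|\ \forall\,\lambda\geq 0\}$ and $x^-=\{y\in\mathbb{X}:\|x+\lambda y\|\geq\|x\|\ \forall\,\lambda\leq 0\}$. *)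

theory Defs
  imports "HOL-Analysis.Analysis"
begin

definition birkhoff_james_orthogonal :: "'b::real_normed_vector \<Rightarrow> 'b \<Rightarrow> bool"
    (infix \<open>\<bottom>\<^sub>B\<close> 50)
  where "x \<bottom>\<^sub>B y \<longleftrightarrow> (\<forall>t::real. norm (x + t *\<^sub>R y) \<ge> norm x)"

text \<open>The sets \<open>x\<^sup>+\<close> and \<open>x\<^sup>-\<close>, which are only of interest for non-zero \<open>x\<close>
  (both are the whole space for \<open>x = 0\<close>).\<close>

definition bj_plus :: "'b::real_normed_vector \<Rightarrow> 'b set"
  where "bj_plus x = {y. \<forall>t::real. t \<ge> 0 \<longrightarrow> norm (x + t *\<^sub>R y) \<ge> norm x}"

definition bj_minus :: "'b::real_normed_vector \<Rightarrow> 'b set"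
  where "bj_minus x = {y. \<forall>t::real. t \<le> 0 \<longrightarrow> norm (x + t *\<^sub>R y) \<ge> norm x}"

text \<open>The library type \<open>'a \<Rightarrow>\<^sub>C 'b\<close> of bounded continuous functions carries the
  supremum norm. When \<open>'a\<close> is compact, boundedness is automatic, so that this type is the
  space of all continuous functions; the next two lemmas record both facts.\<close>

lemma compact_bcontfun_iff_continuous:
  fixes f :: "'a::topological_space \<Rightarrow> 'b::metric_space"
  assumes "compact (UNIV :: 'a set)"
  shows "f \<in> bcontfun \<longleftrightarrow> continuous_on UNIV f"
  using assms by (auto simp: bcontfun_def intro: compact_imp_bounded compact_continuous_image)

lemma norm_bcontfun_eq_SUP:
  fixes f :: "'a::topological_space \<Rightarrow>\<^sub>C 'b::real_normed_vector"
  shows "norm f = (SUP u. norm (apply_bcontfun f u))"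
  by (simp add: norm_bcontfun_def dist_bcontfun.rep_eq)

definition norm_attainment_set ::
    "('a::topological_space \<Rightarrow>\<^sub>C 'b::real_normed_vector) \<Rightarrow> 'a set"
  where "norm_attainment_set f = {u. norm (apply_bcontfun f u) = norm f}"

end

theory Submission
  imports Defs
begin

text \<open>Each one-sided half of Birkhoff-James orthogonality localises at a point. Suppose
  \<open>norm (f + t *\<^sub>R g) \<ge> norm f\<close> for all \<open>t > 0\<close>, and let
  \<open>K t = {u. norm (f u + t *\<^sub>R g u) \<ge> norm f}\<close>. Each \<open>K t\<close> is closed, and it is non-empty
  because the supremum norm of \<open>f + t *\<^sub>R g\<close> is attained on a compact domain. By convexity of
  the norm, \<open>K s \<subseteq> K t\<close> for \<open>0 < s \<le> t\<close>, so the finite intersection property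
  gives a point \<open>u\<close> of all the \<open>K t\<close> with \<open>t > 0\<close>. Letting \<open>t\<close> tend to \<open>0\<close> shows that \<open>f\<close>
  attains its norm at \<open>u\<close>, and then \<open>u \<in> K t\<close> for all \<open>t > 0\<close> says that
  \<open>g u \<in> bj_plus (f u)\<close>. The half with \<open>t < 0\<close> follows on replacing \<open>g\<close> by \<open>- g\<close>.
  The converse implication is evaluation at \<open>u1\<close> and \<open>u2\<close>.\<close>

lemma norm_attainment_set_nonempty:
  fixes f :: "'a::topological_space \<Rightarrow>\<^sub>C 'b::real_normed_vector"
  assumes "compact (UNIV :: 'a set)"
  shows "norm_attainment_set f \<noteq> {}"
proof -
  have "continuous_on UNIV (\<lambda>u. norm (apply_bcontfun f u))"
    by (intro continuous_intros continuous_on_apply_bcontfun)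
  then obtain u where u: "\<And>v. norm (apply_bcontfun f v) \<le> norm (apply_bcontfun f u)"
    using continuous_attains_sup[OF assms] by auto
  have "norm f \<le> norm (apply_bcontfun f u)"
    by (rule norm_bound) (rule u)
  with norm_bounded[of f u] show ?thesis
    by (auto simp: norm_attainment_set_def intro: antisym)
qed

lemma norm_add_scaleR_ge_mono:
  fixes x y :: "'b::real_normed_vector"
  assumes "norm x \<le> c" and "c \<le> norm (x + s *\<^sub>R y)" and "0 < s" and "s \<le> t"
  shows "c \<le> norm (x + t *\<^sub>R y)"
proof -
  have "t > 0" using assms by simp
  \<comment> \<open>\<open>x + s *\<^sub>R y\<close> lies on the segment from \<open>x\<close> to \<open>x + t *\<^sub>R y\<close>.\<close>
  have eq: "t *\<^sub>R (x + s *\<^sub>R y) = (t - s) *\<^sub>R x + s *\<^sub>R (x + t *\<^sub>R y)"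
    by (simp add: algebra_simps)
  have "t * c \<le> norm (t *\<^sub>R (x + s *\<^sub>R y))"
    using assms \<open>t > 0\<close> by simp
  also have "\<dots> \<le> (t - s) * norm x + s * norm (x + t *\<^sub>R y)"
    unfolding eq using assms by (intro norm_triangle_le) simp
  also have "\<dots> \<le> (t - s) * c + s * norm (x + t *\<^sub>R y)"
    using assms by (intro add_right_mono mult_left_mono) auto
  finally have "s * c \<le> s * norm (x + t *\<^sub>R y)"
    by (simp add: algebra_simps)
  with \<open>0 < s\<close> show ?thesis by simp
qed

lemma mem_bj_minus_iff: "y \<in> bj_minus x \<longleftrightarrow> - y \<in> bj_plus x"
proof -
  have "(\<forall>t\<le>0. norm x \<le> norm (x + t *\<^sub>R y)) \<longleftrightarrow> (\<forall>t\<ge>0. norm x \<le> norm (x + (- t) *\<^sub>R y))"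
    by (metis add.inverse_inverse neg_0_le_iff_le neg_le_0_iff_le)
  then show ?thesis by (simp add: bj_minus_def bj_plus_def)
qed

text \<open>The localisation principle for non-negative parameters, which carries the forward
  implication.\<close>

lemma bj_plus_bcontfun_imp_pointwise:
  fixes f g :: "'a::topological_space \<Rightarrow>\<^sub>C 'b::real_normed_vector"
  assumes compact: "compact (UNIV :: 'a set)" and "g \<in> bj_plus f"
  shows "\<exists>u \<in> norm_attainment_set f. apply_bcontfun g u \<in> bj_plus (apply_bcontfun f u)"
proof -
  define K where "K t = {u. norm f \<le> norm (apply_bcontfun f u + t *\<^sub>R apply_bcontfun g u)}" for t
  have closed: "closed (K t)" for t
    unfolding K_def
    by (intro closed_Collect_le continuous_intros continuous_on_apply_bcontfun)
  have nonempty: "K t \<noteq> {}" if "t > 0" for t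
  proof -
    obtain u where "u \<in> norm_attainment_set (f + t *\<^sub>R g)"
      using norm_attainment_set_nonempty[OF compact] by blast
    moreover have "norm f \<le> norm (f + t *\<^sub>R g)"
      using \<open>g \<in> bj_plus f\<close> that by (simp add: bj_plus_def)
    ultimately have "u \<in> K t"
      by (simp add: K_def norm_attainment_set_def)
    then show ?thesis by blast
  qed
  have mono: "K s \<subseteq> K t" if "0 < s" "s \<le> t" for s t
    using that by (auto simp: K_def intro: norm_add_scaleR_ge_mono[OF norm_bounded])
  have "UNIV \<inter> (\<Inter>t\<in>{0<..}. K t) \<noteq> {}"
  proof (rule compact_imp_fip_image[OF compact closed])
    fix I :: "real set"
    assume I: "finite I" "I \<subseteq> {0<..}"
    show "UNIV \<inter> (\<Inter>t\<in>I. K t) \<noteq> {}"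
    proof (cases "I = {}")
      case False
      then have "Min I > 0" using I by auto
      moreover from this have "K (Min I) \<subseteq> (\<Inter>t\<in>I. K t)"
        using mono I by (intro INT_greatest) auto
      ultimately show ?thesis using nonempty by blast
    qed simp
  qed
  then obtain u where u: "norm f \<le> norm (apply_bcontfun f u + t *\<^sub>R apply_bcontfun g u)"
    if "t > 0" for t
    by (auto simp: K_def)
  have "((\<lambda>t. norm (apply_bcontfun f u + t *\<^sub>R apply_bcontfun g u))
      \<longlongrightarrow> norm (apply_bcontfun f u + 0 *\<^sub>R apply_bcontfun g u)) (at_right 0)"
    by (intro tendsto_intros)
  moreover have "\<forall>\<^sub>F t in at_right 0.
      norm f \<le> norm (apply_bcontfun f u + t *\<^sub>R apply_bcontfun g u)"
    using eventually_at_right_less by (rule eventually_mono) (rule u)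
  ultimately have "norm f \<le> norm (apply_bcontfun f u)"
    using tendsto_lowerbound by fastforce
  then have attained: "norm (apply_bcontfun f u) = norm f"
    using norm_bounded[of f u] by simp
  have "norm (apply_bcontfun f u) \<le> norm (apply_bcontfun f u + t *\<^sub>R apply_bcontfun g u)"
    if "t \<ge> 0" for t
    using u[of t] that attained by (cases "t = 0") auto
  with attained show ?thesis
    by (auto simp: norm_attainment_set_def bj_plus_def)
qed

lemma pointwise_imp_bj_plus_bcontfun:
  fixes f g :: "'a::topological_space \<Rightarrow>\<^sub>C 'b::real_normed_vector"
  assumes "u \<in> norm_attainment_set f"
    and "apply_bcontfun g u \<in> bj_plus (apply_bcontfun f u)"
  shows "g \<in> bj_plus f"
  unfolding bj_plus_def
proof (intro CollectI allI impI)
  fix t :: real assume "t \<ge> 0"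
  then have "norm f \<le> norm (apply_bcontfun (f + t *\<^sub>R g) u)"
    using assms by (simp add: norm_attainment_set_def bj_plus_def)
  also have "\<dots> \<le> norm (f + t *\<^sub>R g)"
    by (rule norm_bounded)
  finally show "norm f \<le> norm (f + t *\<^sub>R g)" .
qed

lemma bj_plus_bcontfun_iff:
  fixes f g :: "'a::topological_space \<Rightarrow>\<^sub>C 'b::real_normed_vector"
  assumes "compact (UNIV :: 'a set)"
  shows "g \<in> bj_plus f \<longleftrightarrow>
    (\<exists>u \<in> norm_attainment_set f. apply_bcontfun g u \<in> bj_plus (apply_bcontfun f u))"
  using bj_plus_bcontfun_imp_pointwise[OF assms] pointwise_imp_bj_plus_bcontfun by blast

lemma birkhoff_james_orthogonal_iff_plus_minus:
  "x \<bottom>\<^sub>B y \<longleftrightarrow> y \<in> bj_plus x \<and> y \<in> bj_minus x"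
  unfolding birkhoff_james_orthogonal_def bj_plus_def bj_minus_def
  using linear by blast

theorem theorem2p1:
  fixes f g :: "'a::topological_space \<Rightarrow>\<^sub>C 'b::real_normed_vector"
  assumes "compact (UNIV :: 'a set)"
    and "f \<noteq> 0" and "g \<noteq> 0"
  shows "f \<bottom>\<^sub>B g \<longleftrightarrow>
    (\<exists>u1 u2. u1 \<in> norm_attainment_set f \<and> u2 \<in> norm_attainment_set f \<and>
      apply_bcontfun g u1 \<in> bj_plus (apply_bcontfun f u1) \<and>
      apply_bcontfun g u2 \<in> bj_minus (apply_bcontfun f u2))"
  unfolding birkhoff_james_orthogonal_iff_plus_minus mem_bj_minus_iff
    bj_plus_bcontfun_iff[OF assms(1)]
  by auto

end
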